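(* Let $\mathcal F_{RS}=\{I_2,T_3\}$, where $I_2$ is the $3$-graph consisting of two edges sharing exactly two vertices, and $T_3=\{e,f,g\}$ is the $3$-uniform loose triangle, i.e. $|e\cap f|=|f\cap g|=|g\cap e|=1$ and $e\cap f\cap g=\emptyset$. Then $$\mathrm{ex}_{\to}(n,\mathrm{ord}(\mathcal F_{RS}))=o(n^2)\qquad (n\to\infty).$$
   Context: A $3$-graph is a finite hypergraph all of whose edges have size $3$; hypergraphs are identified with their edge sets. An ordered $3$-graph is a $3$-graph with a linear ordering of its vertex set. An ordered $3$-graph is interval $3$-partite if there are intervals (sets of consecutive vertices) $I_1<I_2<I_3$ in the vertex ordering such that every edge has exactly one vertex in each $I_j$ (where $A<B$ means that every element of $A$ precedes every element of $B$). For a $3$-partite $3$-graph $F$, $\mathrm{ord}(F)$ is the family of interval $3$-partite ordered $3$-graphs that are isomorphic to $F$ as unordered $3$-graphs. For a family $\mathcal F$ of $3$-partite $3$-graphs, $\mathrm{ord}(\mathcal F)=\bigcup_{F\in\mathcal F}\mathrm{ord}(F)$. An ordered $3$-graph $H$ contains an ordered $3$-graph $F$ if there is an order-preserving injection $V(F)\to V(H)$ mapping edges to edges. For a family $\mathcal G$ of ordered $3$-graphs, $\mathrm{ex}_{\to}(n,\mathcal G)$ is the maximum number of edges in an $n$-vertex ordered $3$-graph that contains no member of $\mathcal G$. *)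

theory Defs
  imports Complex_Main "HOL-Library.Landau_Symbols"
begin

record 'a hypergraph =
  verts :: "'a set"
  edges :: "'a set set"

text \<open>The field \<open>vle\<close> is the reflexive linear order on the vertex set.\<close>

record 'a ordered_hypergraph = "'a hypergraph" +
  vle :: "'a rel"

definition three_graph :: "('a, 'x) hypergraph_scheme \<Rightarrow> bool" where
  "three_graph F \<longleftrightarrow> finite (verts F) \<and> (\<forall>e\<in>edges F. e \<subseteq> verts F \<and> card e = 3)"

definition ordered_three_graph :: "'a ordered_hypergraph \<Rightarrow> bool" where
  "ordered_three_graph H \<longleftrightarrow> three_graph H \<and> linear_order_on (verts H) (vle H)"

definition is_interval_of :: "'a ordered_hypergraph \<Rightarrow> 'a set \<Rightarrow> bool" where
  "is_interval_of H I \<longleftrightarrow> I \<subseteq> verts H \<and>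
     (\<forall>x\<in>I. \<forall>z\<in>I. \<forall>y\<in>verts H. (x, y) \<in> vle H \<longrightarrow> (y, z) \<in> vle H \<longrightarrow> y \<in> I)"

definition set_precedes :: "'a ordered_hypergraph \<Rightarrow> 'a set \<Rightarrow> 'a set \<Rightarrow> bool" where
  "set_precedes H A B \<longleftrightarrow> (\<forall>a\<in>A. \<forall>b\<in>B. (a, b) \<in> vle H \<and> a \<noteq> b)"

definition interval_three_partite :: "'a ordered_hypergraph \<Rightarrow> bool" where
  "interval_three_partite H \<longleftrightarrow>
     (\<exists>I1 I2 I3. is_interval_of H I1 \<and> is_interval_of H I2 \<and> is_interval_of H I3 \<and>
        set_precedes H I1 I2 \<and> set_precedes H I2 I3 \<and> set_precedes H I1 I3 \<and>
        (\<forall>e\<in>edges H. card (e \<inter> I1) = 1 \<and> card (e \<inter> I2) = 1 \<and> card (e \<inter> I3) = 1))"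

definition hypergraph_iso ::
    "('a, 'x) hypergraph_scheme \<Rightarrow> ('b, 'y) hypergraph_scheme \<Rightarrow> bool" where
  "hypergraph_iso F G \<longleftrightarrow>
     (\<exists>\<phi>. bij_betw \<phi> (verts F) (verts G) \<and> edges G = (\<lambda>e. \<phi> ` e) ` edges F)"

text \<open>
  Labels in \<open>nat\<close> lose nothing: the order is carried by \<open>vle\<close>, independently of the
  order on \<open>nat\<close>, and every finite ordered 3-graph has an isomorphic copy with such labels.
\<close>

definition ord_graph :: "nat hypergraph \<Rightarrow> nat ordered_hypergraph set" where
  "ord_graph F = {G. ordered_three_graph G \<and> interval_three_partite G \<and> hypergraph_iso F G}"

definition ord_family :: "nat hypergraph set \<Rightarrow> nat ordered_hypergraph set" where
  "ord_family \<F> = (\<Union>F\<in>\<F>. ord_graph F)"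

definition contains :: "'a ordered_hypergraph \<Rightarrow> 'b ordered_hypergraph \<Rightarrow> bool" where
  "contains H F \<longleftrightarrow>
     (\<exists>\<phi>. inj_on \<phi> (verts F) \<and> \<phi> ` verts F \<subseteq> verts H \<and>
        (\<forall>x\<in>verts F. \<forall>y\<in>verts F. (x, y) \<in> vle F \<longrightarrow> (\<phi> x, \<phi> y) \<in> vle H) \<and>
        (\<forall>e\<in>edges F. \<phi> ` e \<in> edges H))"

definition ex_ordered :: "nat \<Rightarrow> nat ordered_hypergraph set \<Rightarrow> nat" where
  "ex_ordered n \<G> =
     Max {card (edges H) | H :: nat ordered_hypergraph.
            ordered_three_graph H \<and> card (verts H) = n \<and> (\<forall>G\<in>\<G>. \<not> contains H G)}"

definition I2 :: "nat hypergraph" where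
  "I2 = \<lparr>verts = {0, 1, 2, 3}, edges = {{0, 1, 2}, {0, 1, 3}}\<rparr>"

definition T3 :: "nat hypergraph" where
  "T3 = \<lparr>verts = {0, 1, 2, 3, 4, 5}, edges = {{0, 1, 2}, {2, 3, 4}, {4, 5, 0}}\<rparr>"

definition F_RS :: "nat hypergraph set" where
  "F_RS = {I2, T3}"

text \<open>
  The representatives chosen above are the intended 3-graphs: the stated intersection
  patterns, with no isolated vertices, determine them up to isomorphism.
\<close>

lemma I2_spec:
  "three_graph I2"
  "\<exists>e f. edges I2 = {e, f} \<and> e \<noteq> f \<and> card (e \<inter> f) = 2 \<and> verts I2 = e \<union> f"
proof -
  show "three_graph I2" by (simp add: three_graph_def I2_def)
  show "\<exists>e f. edges I2 = {e, f} \<and> e \<noteq> f \<and> card (e \<inter> f) = 2 \<and> verts I2 = e \<union> f"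
    by (rule exI[of _ "{0,1,2}"], rule exI[of _ "{0,1,3}"])
      (simp add: I2_def insert_commute insert_eq_iff)
qed

lemma T3_spec:
  "three_graph T3"
  "\<exists>e f g. edges T3 = {e, f, g} \<and> card (e \<inter> f) = 1 \<and> card (f \<inter> g) = 1 \<and>
     card (g \<inter> e) = 1 \<and> e \<inter> f \<inter> g = {} \<and> verts T3 = e \<union> f \<union> g"
proof -
  show "three_graph T3" by (simp add: three_graph_def T3_def)
  show "\<exists>e f g. edges T3 = {e, f, g} \<and> card (e \<inter> f) = 1 \<and> card (f \<inter> g) = 1 \<and>
     card (g \<inter> e) = 1 \<and> e \<inter> f \<inter> g = {} \<and> verts T3 = e \<union> f \<union> g"
    by (rule exI[of _ "{0,1,2}"], rule exI[of _ "{2,3,4}"], rule exI[of _ "{4,5,0}"])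
      (simp add: T3_def insert_commute)
qed

text \<open>The maximum defining \<open>ex_ordered\<close> is over a finite set, nonempty for \<open>ord_family F_RS\<close>.\<close>

lemma finite_ex_ordered_set:
  "finite {card (edges H) | H :: nat ordered_hypergraph.
     ordered_three_graph H \<and> card (verts H) = n \<and> (\<forall>G\<in>\<G>. \<not> contains H G)}"
proof (rule finite_subset)
  show "{card (edges H) | H :: nat ordered_hypergraph.
     ordered_three_graph H \<and> card (verts H) = n \<and> (\<forall>G\<in>\<G>. \<not> contains H G)} \<subseteq> {..2 ^ n}"
  proof clarsimp
    fix H :: "nat ordered_hypergraph"
    assume "ordered_three_graph H"
    then have fin: "finite (verts H)" and sub: "edges H \<subseteq> Pow (verts H)"
      by (auto simp: ordered_three_graph_def three_graph_def)
    show "card (edges H) \<le> 2 ^ card (verts H)"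
      using card_mono[OF _ sub] fin by (simp add: card_Pow)
  qed
qed simp

lemma ex_ordered_set_nonempty:
  "{card (edges H) | H :: nat ordered_hypergraph.
     ordered_three_graph H \<and> card (verts H) = n \<and> (\<forall>G\<in>ord_family F_RS. \<not> contains H G)} \<noteq> {}"
proof -
  define H :: "nat ordered_hypergraph" where
    "H = \<lparr>verts = {..<n}, edges = {}, vle = {(x, y). x \<le> y \<and> y < n}\<rparr>"
  have "ordered_three_graph H"
    by (auto simp: ordered_three_graph_def three_graph_def H_def order_on_defs refl_on_def
        trans_def antisym_def total_on_def)
  moreover have "\<not> contains H G" if "G \<in> ord_family F_RS" for G
  proof -
    have "edges I2 \<noteq> {}" "edges T3 \<noteq> {}" by (simp_all add: I2_def T3_def)
    then have "edges G \<noteq> {}"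
      using that by (auto simp: ord_family_def ord_graph_def F_RS_def hypergraph_iso_def)
    then show ?thesis by (auto simp: contains_def H_def)
  qed
  moreover have "card (verts H) = n" by (simp add: H_def)
  ultimately show ?thesis by blast
qed

end

theory Submission
  imports Defs "HOL-Analysis.Convex"
begin

text \<open>
  Cut the vertex ordering into a bounded number of blocks. Since the interval copies of the two edges
  sharing a pair are forbidden, a pair of vertices extends to at most one edge on its right and at
  most one on its left, so few edges have two vertices in one block. The other edges fall into
  boundedly many classes, one for each triple of blocks; inside a class every copy of a forbidden
  3-graph is automatically interval 3-partite, so each class obeys the Ruzsa--Szemeredi (6,3)
  theorem.

  For the latter, project a class to the pairs formed by its last two coordinates. The links of the
  first coordinates decompose this bipartite graph into linearly many induced matchings. A
  one-sided regularity lemma, proved by energy increment over partitions generated by finite set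
  families, shows that each matching has only a small linear number of edges outside the
  exceptional pairs of cells.
\<close>

section \<open>Regularity by energy increment\<close>

text \<open>This is the conditional expectation of \<open>f\<close> under the uniform measure on
  \<open>S\<close>, given the partition of \<open>S\<close> into the fibres of
  \<open>P\<close>.\<close>

definition cell_mean :: "'s set \<Rightarrow> ('s \<Rightarrow> 'c) \<Rightarrow> ('s \<Rightarrow> real) \<Rightarrow> 's \<Rightarrow> real" where
  "cell_mean S P f s = (\<Sum>t\<in>{t\<in>S. P t = P s}. f t) / real (card {t\<in>S. P t = P s})"

lemma cell_mean_cong: "P s = P t \<Longrightarrow> cell_mean S P f s = cell_mean S P f t"
  by (simp add: cell_mean_def)

lemma cell_mean_nonneg: "(\<And>s. s \<in> S \<Longrightarrow> 0 \<le> f s) \<Longrightarrow> 0 \<le> cell_mean S P f s"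
  unfolding cell_mean_def by (intro divide_nonneg_nonneg sum_nonneg) auto

lemma cell_mean_le_1:
  assumes "\<And>s. s \<in> S \<Longrightarrow> f s \<le> 1"
  shows "cell_mean S P f s \<le> 1"
proof -
  have "(\<Sum>t\<in>{t\<in>S. P t = P s}. f t) \<le> real (card {t\<in>S. P t = P s}) * 1"
    by (rule sum_bounded_above) (use assms in auto)
  then show ?thesis
    unfolding cell_mean_def by (cases "card {t\<in>S. P t = P s} = 0") (simp_all add: divide_le_eq_1)
qed

text \<open>The defining property of conditional expectation: after exchanging the double sum,
  \<open>h\<close> and the cell size are constant on each cell, so the number of terms cancels the
  denominator. Used mostly with \<open>h\<close> the indicator of a union of cells.\<close>

lemma sum_mult_cell_mean:
  assumes fin: "finite S"
    and h: "\<And>s t. s \<in> S \<Longrightarrow> t \<in> S \<Longrightarrow> P s = P t \<Longrightarrow> h s = h t"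
  shows "(\<Sum>s\<in>S. h s * cell_mean S P f s) = (\<Sum>s\<in>S. h s * f s)"
proof -
  define c where "c s = real (card {t\<in>S. P t = P s})" for s
  have cpos: "c s > 0" if "s \<in> S" for s
    unfolding c_def using fin that by (auto simp: card_gt_0_iff)
  have "(\<Sum>s\<in>S. h s * cell_mean S P f s)
      = (\<Sum>s\<in>S. \<Sum>t\<in>{t\<in>S. P t = P s}. h s * f t / c s)"
    unfolding cell_mean_def c_def by (simp add: sum_distrib_left sum_divide_distrib)
  also have "\<dots> = (\<Sum>t\<in>S. \<Sum>s\<in>{s\<in>S. P t = P s}. h s * f t / c s)"
    by (rule sum.swap_restrict) (use fin in auto)
  also have "\<dots> = (\<Sum>t\<in>S. \<Sum>s\<in>{s\<in>S. P s = P t}. h t * f t / c t)"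
    by (intro sum.cong refl) (auto simp: c_def intro: h)
  also have "\<dots> = (\<Sum>t\<in>S. h t * f t)"
    by (intro sum.cong refl) (use cpos in \<open>force simp: c_def\<close>)
  finally show ?thesis .
qed

text \<open>Pythagoras: the mean over the coarser partition \<open>P\<close> is constant on the
  cells of \<open>Q\<close>, so it has the same inner product with the fine mean, with
  \<open>f\<close> and with itself.\<close>

lemma sum_cell_mean_diff_squared:
  assumes fin: "finite S"
    and ref: "\<And>s t. s \<in> S \<Longrightarrow> t \<in> S \<Longrightarrow> Q s = Q t \<Longrightarrow> P s = P t"
  shows "(\<Sum>s\<in>S. (cell_mean S Q f s - cell_mean S P f s)\<^sup>2)
    = (\<Sum>s\<in>S. (cell_mean S Q f s)\<^sup>2) - (\<Sum>s\<in>S. (cell_mean S P f s)\<^sup>2)"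
proof -
  let ?g = "cell_mean S P f" and ?g' = "cell_mean S Q f"
  have "(\<Sum>s\<in>S. ?g s * ?g' s) = (\<Sum>s\<in>S. ?g s * f s)"
    by (rule sum_mult_cell_mean[OF fin]) (blast intro: cell_mean_cong ref)
  also have "\<dots> = (\<Sum>s\<in>S. ?g s * ?g s)"
    by (rule sum_mult_cell_mean[OF fin, symmetric]) (blast intro: cell_mean_cong)
  finally have "(\<Sum>s\<in>S. ?g s * ?g' s) = (\<Sum>s\<in>S. (?g s)\<^sup>2)"
    by (simp add: power2_eq_square)
  moreover have "(\<Sum>s\<in>S. (?g' s - ?g s)\<^sup>2)
      = (\<Sum>s\<in>S. (?g' s)\<^sup>2) + (\<Sum>s\<in>S. (?g s)\<^sup>2) - 2 * (\<Sum>s\<in>S. ?g s * ?g' s)"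
    by (simp add: power2_diff sum_subtractf sum.distrib sum_distrib_left mult_ac)
  ultimately show ?thesis by simp
qed

text \<open>
  Partitions of the vertex set are represented by finite set families: the cells are the atoms
  of the family, and enlarging the family refines the partition.
\<close>

definition profile :: "'a set set \<Rightarrow> 'a \<Rightarrow> 'a set set" where
  "profile \<A> x = {A\<in>\<A>. x \<in> A}"

definition atom :: "'a set \<Rightarrow> 'a set set \<Rightarrow> 'a \<Rightarrow> 'a set" where
  "atom V \<A> x = {y\<in>V. profile \<A> y = profile \<A> x}"

definition edge_density :: "('a \<times> 'a) set \<Rightarrow> 'a set \<Rightarrow> 'a set \<Rightarrow> real" where
  "edge_density R X Y = real (card (R \<inter> X \<times> Y)) / (real (card X) * real (card Y))"

text \<open>
  Only density drops count, and only in cells of density at least \<open>\<epsilon>\<close>; this one-sided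
  notion suffices for induced matchings.
\<close>

definition irregular :: "real \<Rightarrow> ('a \<times> 'a) set \<Rightarrow> 'a set \<Rightarrow> 'a set \<Rightarrow> bool" where
  "irregular \<epsilon> R C D \<longleftrightarrow> \<epsilon> \<le> edge_density R C D \<and>
     (\<exists>X Y. X \<subseteq> C \<and> Y \<subseteq> D \<and>
        \<epsilon> * real (card C) \<le> real (card X) \<and> \<epsilon> * real (card D) \<le> real (card Y) \<and>
        real (card (R \<inter> X \<times> Y)) < edge_density R C D / 2 * real (card X * card Y))"

text \<open>Counting pairs of vertices weights each irregular pair of atoms by the product of their
  sizes.\<close>

definition irregular_pairs :: "real \<Rightarrow> 'a set \<Rightarrow> ('a \<times> 'a) set \<Rightarrow> 'a set set \<Rightarrow> ('a \<times> 'a) set" where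
  "irregular_pairs \<epsilon> V R \<A> = {(x, y) \<in> V \<times> V. irregular \<epsilon> R (atom V \<A> x) (atom V \<A> y)}"

definition pair_profile :: "'a set set \<Rightarrow> 'a \<times> 'a \<Rightarrow> 'a set set \<times> 'a set set" where
  "pair_profile \<A> = map_prod (profile \<A>) (profile \<A>)"

text \<open>The unnormalised index of regularity theory: for finite \<open>V\<close>, each pair of
  atoms contributes its squared density times the product of the two sizes.\<close>

definition energy :: "'a set \<Rightarrow> ('a \<times> 'a) set \<Rightarrow> 'a set set \<Rightarrow> real" where
  "energy V R \<A> =
     (\<Sum>s\<in>V \<times> V. (cell_mean (V \<times> V) (pair_profile \<A>) (\<lambda>s. of_bool (s \<in> R)) s)\<^sup>2)"

lemma atom_subset: "atom V \<A> x \<subseteq> V"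
  by (auto simp: atom_def)

lemma mem_atom: "x \<in> V \<Longrightarrow> x \<in> atom V \<A> x"
  by (simp add: atom_def)

lemma finite_atom: "finite V \<Longrightarrow> finite (atom V \<A> x)"
  by (simp add: atom_def)

lemma pair_cell_eq:
  "{t \<in> V \<times> V. pair_profile \<A> t = pair_profile \<A> (x, y)} = atom V \<A> x \<times> atom V \<A> y"
  by (auto simp: pair_profile_def atom_def)

lemma cell_mean_pair:
  "cell_mean (V \<times> V) (pair_profile \<A>) f (x, y)
    = (\<Sum>t\<in>atom V \<A> x \<times> atom V \<A> y. f t)
      / (real (card (atom V \<A> x)) * real (card (atom V \<A> y)))"
  unfolding cell_mean_def pair_cell_eq by (simp add: card_cartesian_product)

lemma cell_mean_pair_density:
  assumes "finite V"
  shows "cell_mean (V \<times> V) (pair_profile \<A>) (\<lambda>s. of_bool (s \<in> R)) (x, y)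
    = edge_density R (atom V \<A> x) (atom V \<A> y)"
  using assms by (simp add: cell_mean_pair edge_density_def finite_atom Int_commute)

text \<open>An atom is determined by the subfamily of \<open>\<A>\<close> containing its points, and
  \<open>\<A>\<close> has \<open>2 ^ card \<A>\<close> subfamilies.\<close>

lemma card_atoms_le:
  assumes "finite \<A>"
  shows "finite (atom V \<A> ` V)" "card (atom V \<A> ` V) \<le> 2 ^ card \<A>"
proof -
  have sub: "atom V \<A> ` V \<subseteq> (\<lambda>c. {y\<in>V. profile \<A> y = c}) ` Pow \<A>"
    by (auto simp: atom_def profile_def)
  show "finite (atom V \<A> ` V)"
    by (rule finite_subset[OF sub]) (use assms in simp)
  have "card (atom V \<A> ` V) \<le> card ((\<lambda>c. {y\<in>V. profile \<A> y = c}) ` Pow \<A>)"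
    by (rule card_mono[OF _ sub]) (use assms in simp)
  also have "\<dots> \<le> card (Pow \<A>)"
    by (rule card_image_le) (use assms in simp)
  finally show "card (atom V \<A> ` V) \<le> 2 ^ card \<A>"
    using assms by (simp add: card_Pow)
qed

lemma energy_le:
  assumes "finite V"
  shows "energy V R \<A> \<le> (real (card V))\<^sup>2"
proof -
  have "energy V R \<A> \<le> real (card (V \<times> V)) * 1"
    unfolding energy_def
    by (intro sum_bounded_above power_le_one cell_mean_nonneg cell_mean_le_1) auto
  then show ?thesis by (simp add: card_cartesian_product power2_eq_square)
qed

lemma energy_nonneg: "0 \<le> energy V R \<A>"
  unfolding energy_def by (intro sum_nonneg) auto

text \<open>Refine by the witnesses of all irregular pairs of atoms at once. On a witness rectangle
  the old mean equals the density d of the pair, while the new mean averages below d/2;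
  Cauchy-Schwarz makes the squared change large there, and Pythagoras turns it into an energy
  gain.\<close>

lemma energy_increment:
  fixes \<epsilon> :: real
  assumes V: "finite V" and \<A>: "finite \<A>" and \<epsilon>: "0 < \<epsilon>"
  obtains \<B> where "finite \<B>" "card \<B> \<le> card \<A> + 2 * (2 ^ card \<A>)\<^sup>2"
    "energy V R \<A> + \<epsilon> ^ 4 / 4 * card (irregular_pairs \<epsilon> V R \<A>) \<le> energy V R \<B>"
proof -
  have "\<forall>C D. \<exists>X Y. irregular \<epsilon> R C D \<longrightarrow> X \<subseteq> C \<and> Y \<subseteq> D \<and> \<epsilon> * card C \<le> card X \<and>
      \<epsilon> * card D \<le> card Y \<and> card (R \<inter> X \<times> Y) < edge_density R C D / 2 * (card X * card Y)"
    unfolding irregular_def by blast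
  then obtain X Y where XY: "irregular \<epsilon> R C D \<Longrightarrow> X C D \<subseteq> C \<and> Y C D \<subseteq> D \<and>
      \<epsilon> * card C \<le> card (X C D) \<and> \<epsilon> * card D \<le> card (Y C D) \<and>
      card (R \<inter> X C D \<times> Y C D) < edge_density R C D / 2 * (card (X C D) * card (Y C D))" for C D
    by metis
  define At where "At = atom V \<A> ` V"
  \<comment> \<open>The witnesses depend only on the pair of atoms, which bounds how many sets are
    added. Arbitrary values at pairs that are not irregular do no harm: they can only refine the
    partition.\<close>
  define \<B> where "\<B> = \<A> \<union> (\<lambda>(C, D). X C D) ` (At \<times> At) \<union> (\<lambda>(C, D). Y C D) ` (At \<times> At)"
  have At: "finite At" "card At \<le> 2 ^ card \<A>"
    unfolding At_def using card_atoms_le[OF \<A>] by auto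
  have AtAt: "card (At \<times> At) \<le> (2 ^ card \<A>)\<^sup>2"
    using At(2) by (simp add: card_cartesian_product power2_eq_square mult_mono)
  have fin\<B>: "finite \<B>" unfolding \<B>_def using \<A> At by auto
  have "card \<B> \<le> card \<A> + card ((\<lambda>(C, D). X C D) ` (At \<times> At)) + card ((\<lambda>(C, D). Y C D) ` (At \<times> At))"
    unfolding \<B>_def by (meson add_mono card_Un_le order_refl order_trans)
  also have "\<dots> \<le> card \<A> + (2 ^ card \<A>)\<^sup>2 + (2 ^ card \<A>)\<^sup>2"
    using AtAt At(1) by (intro add_mono order_refl order_trans[OF card_image_le]) auto
  finally have card\<B>: "card \<B> \<le> card \<A> + 2 * (2 ^ card \<A>)\<^sup>2" by simp

  define S where "S = V \<times> V"
  define f :: "'a \<times> 'a \<Rightarrow> real" where "f s = of_bool (s \<in> R)" for s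
  define g where "g = cell_mean S (pair_profile \<A>) f"
  define g' where "g' = cell_mean S (pair_profile \<B>) f"
  define \<phi> where "\<phi> s = (g' s - g s)\<^sup>2" for s
  define I where "I = irregular_pairs \<epsilon> V R \<A>"
  have S: "finite S" unfolding S_def using V by simp
  have profile_sub: "profile \<A> x = profile \<A> y" if "profile \<B> x = profile \<B> y" for x y
    using that unfolding profile_def \<B>_def by blast
  have "(\<Sum>s\<in>S. \<phi> s) = energy V R \<B> - energy V R \<A>"
    unfolding \<phi>_def g_def g'_def energy_def S_def[symmetric] f_def[symmetric]
    by (rule sum_cell_mean_diff_squared[OF S])
      (auto simp: pair_profile_def map_prod_def split_beta intro: profile_sub del: equalityI)
  \<comment> \<open>Since \<open>I\<close> is a union of cells, the sum of \<open>\<phi>\<close>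
    over \<open>I\<close> equals the sum of its cell means there, so it suffices to bound the mean
    of \<open>\<phi>\<close> on each irregular cell.\<close>
  moreover have "\<epsilon> ^ 4 / 4 * card I \<le> (\<Sum>s\<in>S. \<phi> s)"
  proof -
    have mean: "\<epsilon> ^ 4 / 4 \<le> cell_mean S (pair_profile \<A>) \<phi> s" if sI: "s \<in> I" for s
    proof -
      obtain x y where s: "s = (x, y)" by (cases s)
      define C where "C = atom V \<A> x"
      define D where "D = atom V \<A> y"
      have xy: "x \<in> V" "y \<in> V" and irr: "irregular \<epsilon> R C D"
        using sI unfolding s I_def irregular_pairs_def C_def D_def by auto
      define Z where "Z = X C D \<times> Y C D"
      define d where "d = edge_density R C D"
      have sub: "X C D \<subseteq> C" "Y C D \<subseteq> D" and big: "\<epsilon> * card C \<le> card (X C D)" "\<epsilon> * card D \<le> card (Y C D)"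
        and few: "card (R \<inter> Z) < d / 2 * (card (X C D) * card (Y C D))"
        using XY[OF irr] unfolding Z_def d_def by auto
      have d: "\<epsilon> \<le> d" using irr unfolding irregular_def d_def by auto
      have finCD: "finite C" "finite D" unfolding C_def D_def using V by (auto intro: finite_atom)
      have ZCD: "Z \<subseteq> C \<times> D" unfolding Z_def using sub by auto
      have CDS: "C \<times> D \<subseteq> S" unfolding C_def D_def S_def using atom_subset by fastforce
      have finZ: "finite Z" using ZCD finCD finite_subset by blast
      have posC: "0 < card C" "0 < card D"
        using finCD mem_atom[OF xy(1)] mem_atom[OF xy(2)] unfolding C_def D_def by (auto simp: card_gt_0_iff)
      have cardZ: "real (card Z) = real (card (X C D)) * real (card (Y C D))"
        unfolding Z_def by (simp add: card_cartesian_product)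
      have bigZ: "\<epsilon>\<^sup>2 * (card C * card D) \<le> card Z"
      proof -
        have "(\<epsilon> * card C) * (\<epsilon> * card D) \<le> real (card (X C D)) * real (card (Y C D))"
          using big \<epsilon> by (intro mult_mono) auto
        then show ?thesis unfolding cardZ by (simp add: power2_eq_square mult_ac)
      qed
      then have posZ: "0 < real (card Z)"
        using \<epsilon> posC by (smt (verit) mult_pos_pos of_nat_0_less_iff zero_less_power of_nat_mult)
      have gd: "g t = d" if "t \<in> Z" for t
      proof -
        obtain u v where t: "t = (u, v)" by (cases t)
        have "u \<in> C" "v \<in> D" using that ZCD t by auto
        then have "atom V \<A> u = C" "atom V \<A> v = D"
          unfolding C_def D_def atom_def by auto
        then show ?thesis
          unfolding t g_def S_def f_def cell_mean_pair_density[OF V] d_def by simp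
      qed
      have XB: "X C D \<in> \<B>" "Y C D \<in> \<B>"
        unfolding \<B>_def At_def C_def D_def using xy by auto
      \<comment> \<open>Both sides of \<open>Z\<close> belong to \<open>\<B>\<close>, so
        \<open>Z\<close> is a union of cells of the refined partition and \<open>g'\<close> may be
        replaced by \<open>f\<close> in sums over it.\<close>
      have "(\<Sum>t\<in>Z. g' t) = (\<Sum>t\<in>S. of_bool (t \<in> Z) * g' t)"
        using S ZCD CDS by (intro sum.mono_neutral_cong_left) auto
      also have "\<dots> = (\<Sum>t\<in>S. of_bool (t \<in> Z) * f t)"
        unfolding g'_def
      proof (rule sum_mult_cell_mean[OF S])
        fix s t assume eq: "pair_profile \<B> s = pair_profile \<B> t"
        have "fst s \<in> A \<longleftrightarrow> fst t \<in> A" "snd s \<in> A \<longleftrightarrow> snd t \<in> A" if "A \<in> \<B>" for A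
          using eq that unfolding pair_profile_def profile_def
          by (cases s; cases t; auto)+
        then have "s \<in> Z \<longleftrightarrow> t \<in> Z"
          using XB unfolding Z_def by (cases s; cases t) auto
        then show "of_bool (s \<in> Z) = (of_bool (t \<in> Z) :: real)" by simp
      qed
      also have "\<dots> = (\<Sum>t\<in>Z. f t)"
        using S ZCD CDS by (intro sum.mono_neutral_cong_right) auto
      also have "\<dots> = card (R \<inter> Z)"
        unfolding f_def using finZ by (simp add: Int_commute)
      finally have "(\<Sum>t\<in>Z. g' t - g t) = card (R \<inter> Z) - d * card Z"
        using gd by (simp add: sum_subtractf)
      then have "d / 2 * card Z \<le> \<bar>\<Sum>t\<in>Z. g' t - g t\<bar>"
        using few cardZ by (simp add: field_simps)
      then have "(d / 2 * card Z)\<^sup>2 \<le> (\<Sum>t\<in>Z. g' t - g t)\<^sup>2"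
        using d \<epsilon> by (subst abs_le_square_iff[symmetric]) auto
      also have "\<dots> \<le> card Z * (\<Sum>t\<in>Z. \<phi> t)"
        unfolding \<phi>_def using sum_squared_le_sum_of_squares[of "\<lambda>t. g' t - g t" Z]
        by (simp add: mult.commute)
      finally have "card Z * (d\<^sup>2 / 4 * card Z) \<le> card Z * (\<Sum>t\<in>Z. \<phi> t)"
        by (simp add: power2_eq_square field_simps)
      then have "d\<^sup>2 / 4 * card Z \<le> (\<Sum>t\<in>Z. \<phi> t)"
        using posZ by (simp only: mult_le_cancel_left_pos)
      also have "\<dots> \<le> (\<Sum>t\<in>C \<times> D. \<phi> t)"
        using ZCD finCD by (intro sum_mono2) (auto simp: \<phi>_def)
      finally have "d\<^sup>2 / 4 * card Z \<le> (\<Sum>t\<in>C \<times> D. \<phi> t)" .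
      \<comment> \<open>Of the four factors \<open>\<epsilon>\<close>, two come from the density
        bound on \<open>d\<close> and two from the relative size of \<open>Z\<close> in
        \<open>C \<times> D\<close>.\<close>
      moreover have "\<epsilon>\<^sup>2 / 4 * (\<epsilon>\<^sup>2 * (card C * card D)) \<le> d\<^sup>2 / 4 * card Z"
        using bigZ d \<epsilon> by (intro mult_mono divide_right_mono power_mono) auto
      ultimately have "\<epsilon> ^ 4 / 4 * (card C * card D) \<le> (\<Sum>t\<in>C \<times> D. \<phi> t)"
        by (simp add: power4_eq_xxxx power2_eq_square mult_ac)
      then show ?thesis
        unfolding s S_def cell_mean_pair C_def[symmetric] D_def[symmetric]
        using posC by (simp add: pos_le_divide_eq)
    qed
    have IS: "I \<subseteq> S" unfolding I_def S_def irregular_pairs_def by auto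
    have "\<epsilon> ^ 4 / 4 * card I = (\<Sum>s\<in>I. \<epsilon> ^ 4 / 4)" by simp
    also have "\<dots> \<le> (\<Sum>s\<in>I. cell_mean S (pair_profile \<A>) \<phi> s)"
      by (rule sum_mono) (rule mean)
    also have "\<dots> = (\<Sum>s\<in>S. of_bool (s \<in> I) * cell_mean S (pair_profile \<A>) \<phi> s)"
      using S IS by (intro sum.mono_neutral_cong_left) auto
    also have "\<dots> = (\<Sum>s\<in>S. of_bool (s \<in> I) * \<phi> s)"
    proof (rule sum_mult_cell_mean[OF S])
      fix s t assume "s \<in> S" "t \<in> S" and eq: "pair_profile \<A> s = pair_profile \<A> t"
      then have "s \<in> I \<longleftrightarrow> t \<in> I"
        unfolding I_def irregular_pairs_def S_def pair_profile_def
        by (cases s; cases t) (auto simp: atom_def)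
      then show "of_bool (s \<in> I) = (of_bool (t \<in> I) :: real)" by simp
    qed
    also have "\<dots> \<le> (\<Sum>s\<in>S. \<phi> s)"
      by (rule sum_mono) (auto simp: \<phi>_def)
    finally show ?thesis .
  qed
  ultimately have "energy V R \<A> + \<epsilon> ^ 4 / 4 * card (irregular_pairs \<epsilon> V R \<A>) \<le> energy V R \<B>"
    unfolding I_def by simp
  with fin\<B> card\<B> show thesis by (rule that)
qed

section \<open>Iterating the energy increment\<close>

text \<open>Bounds the family size after m refinements: the recursion copies the growth in
  \<open>energy_increment\<close>, and the value 0 belongs to the empty family, whose only atom (if
  \<open>V\<close> is nonempty) is \<open>V\<close>.\<close>

fun tower :: "nat \<Rightarrow> nat" where
  "tower 0 = 0"
| "tower (Suc m) = tower m + 2 * (2 ^ tower m)\<^sup>2"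

text \<open>Every failed attempt gains a fixed fraction of \<open>(card V)\<^sup>2\<close> in
  energy, and the energy never exceeds \<open>(card V)\<^sup>2\<close>, so the number of refinements
  is bounded independently of \<open>V\<close> and \<open>R\<close>.\<close>

lemma regularity:
  fixes \<epsilon> :: real
  assumes \<epsilon>: "0 < \<epsilon>"
  obtains M where "\<And>(V :: 'a set) R. finite V \<Longrightarrow>
    \<exists>\<A>. finite \<A> \<and> card \<A> \<le> M \<and> card (irregular_pairs \<epsilon> V R \<A>) \<le> \<epsilon> * (card V)\<^sup>2"
proof -
  \<comment> \<open>The gain per round: \<open>\<epsilon> ^ 4 / 4\<close> for each of more than
    \<open>\<epsilon> * (card V)\<^sup>2\<close> irregular pairs.\<close>
  define \<delta> where "\<delta> = \<epsilon> ^ 5 / 4"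
  have \<delta>: "\<delta> > 0" unfolding \<delta>_def using \<epsilon> by simp
  \<comment> \<open>The disjunction makes the induction uniform: a family that is already regular is
    simply kept, otherwise m gains have accumulated.\<close>
  have step: "\<exists>\<A>. finite \<A> \<and> card \<A> \<le> tower m \<and>
      (card (irregular_pairs \<epsilon> V R \<A>) \<le> \<epsilon> * (card V)\<^sup>2 \<or> m * \<delta> * (card V)\<^sup>2 \<le> energy V R \<A>)"
    if V: "finite V" for V :: "'a set" and R and m :: nat
  proof (induction m)
    case 0
    show ?case by (rule exI[of _ "{}"]) (simp add: energy_nonneg)
  next
    case (Suc m)
    then obtain \<A> where \<A>: "finite \<A>" "card \<A> \<le> tower m"
      and alt: "card (irregular_pairs \<epsilon> V R \<A>) \<le> \<epsilon> * (card V)\<^sup>2 \<or> m * \<delta> * (card V)\<^sup>2 \<le> energy V R \<A>"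
      by blast
    show ?case
    proof (cases "card (irregular_pairs \<epsilon> V R \<A>) \<le> \<epsilon> * (card V)\<^sup>2")
      case True
      then show ?thesis using \<A> by (intro exI[of _ \<A>]) auto
    next
      case False
      obtain \<B> where \<B>: "finite \<B>" "card \<B> \<le> card \<A> + 2 * (2 ^ card \<A>)\<^sup>2"
        "energy V R \<A> + \<epsilon> ^ 4 / 4 * card (irregular_pairs \<epsilon> V R \<A>) \<le> energy V R \<B>"
        using energy_increment[OF V \<A>(1) \<epsilon>] by blast
      have "card \<A> + 2 * (2 ^ card \<A>)\<^sup>2 \<le> tower (Suc m)"
        using \<A>(2) by (auto intro!: add_mono power_mono mult_left_mono power_increasing)
      moreover have "\<epsilon> ^ 4 / 4 * (\<epsilon> * (card V)\<^sup>2) \<le> \<epsilon> ^ 4 / 4 * card (irregular_pairs \<epsilon> V R \<A>)"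
        using False by (intro mult_left_mono) auto
      then have "\<delta> * (card V)\<^sup>2 \<le> \<epsilon> ^ 4 / 4 * card (irregular_pairs \<epsilon> V R \<A>)"
        unfolding \<delta>_def by (simp add: eval_nat_numeral mult_ac)
      with \<B>(3) alt False have "Suc m * \<delta> * (card V)\<^sup>2 \<le> energy V R \<B>"
        by (simp add: algebra_simps)
      ultimately show ?thesis using \<B>(1,2) by (intro exI[of _ \<B>]) auto
    qed
  qed
  obtain m :: nat where m: "1 < m * \<delta>"
    using reals_Archimedean3[OF \<delta>] by blast
  show thesis
  proof (rule that[of "tower m"])
    fix V :: "'a set" and R assume V: "finite V"
    obtain \<A> where \<A>: "finite \<A>" "card \<A> \<le> tower m"
      and alt: "card (irregular_pairs \<epsilon> V R \<A>) \<le> \<epsilon> * (card V)\<^sup>2 \<or> m * \<delta> * (card V)\<^sup>2 \<le> energy V R \<A>"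
      using step[OF V] by blast
    have "card (irregular_pairs \<epsilon> V R \<A>) \<le> \<epsilon> * (card V)\<^sup>2"
    \<comment> \<open>The contradiction with \<open>energy_le\<close> is strict only when
      \<open>V\<close> is nonempty.\<close>
    proof (cases "card V = 0")
      case True
      then show ?thesis using V by (simp add: irregular_pairs_def)
    next
      case False
      then have "1 * real ((card V)\<^sup>2) < m * \<delta> * real ((card V)\<^sup>2)"
        using m by (intro mult_strict_right_mono) auto
      then show ?thesis using alt energy_le[OF V, of R \<A>] by auto
    qed
    with \<A> show "\<exists>\<A>. finite \<A> \<and> card \<A> \<le> tower m \<and>
        card (irregular_pairs \<epsilon> V R \<A>) \<le> \<epsilon> * (card V)\<^sup>2" by blast
  qed
qed

section \<open>Induced matchings and the (6,3) theorem\<close>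

text \<open>The sparse atoms form a union of cells, so the points of \<open>U\<close> in it may be
  counted by the relative density of \<open>U\<close> in each atom, which is below
  \<open>\<epsilon>\<close> there.\<close>

lemma card_sparse_le:
  fixes \<epsilon> :: real
  assumes V: "finite V" and U: "U \<subseteq> V" and \<epsilon>: "0 < \<epsilon>"
  shows "card {b\<in>U. card (U \<inter> atom V \<A> b) < \<epsilon> * card (atom V \<A> b)} \<le> \<epsilon> * card V"
proof -
  define L where "L = {b\<in>V. card (U \<inter> atom V \<A> b) < \<epsilon> * card (atom V \<A> b)}"
  have "real (card {b\<in>U. card (U \<inter> atom V \<A> b) < \<epsilon> * card (atom V \<A> b)}) = card (V \<inter> (L \<inter> U))"
    unfolding L_def using U by (intro arg_cong[of _ _ "\<lambda>A. real (card A)"]) auto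
  also have "\<dots> = (\<Sum>b\<in>V. of_bool (b \<in> L) * of_bool (b \<in> U))"
    using V by (simp add: of_bool_conj[symmetric] Collect_conj_eq del: of_bool_conj)
  also have "\<dots> = (\<Sum>b\<in>V. of_bool (b \<in> L) * cell_mean V (profile \<A>) (\<lambda>b. of_bool (b \<in> U)) b)"
    by (rule sum_mult_cell_mean[OF V, symmetric]) (auto simp: L_def atom_def)
  also have "\<dots> \<le> (\<Sum>b\<in>V. \<epsilon>)"
  proof (rule sum_mono)
    fix b assume b: "b \<in> V"
    have pos: "0 < card (atom V \<A> b)"
      using mem_atom[OF b] finite_atom[OF V] by (auto simp: card_gt_0_iff)
    have "cell_mean V (profile \<A>) (\<lambda>b. of_bool (b \<in> U)) b = card (U \<inter> atom V \<A> b) / card (atom V \<A> b)"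
      unfolding cell_mean_def atom_def[symmetric] using V by (simp add: finite_atom Int_commute)
    then show "of_bool (b \<in> L) * cell_mean V (profile \<A>) (\<lambda>b. of_bool (b \<in> U)) b \<le> \<epsilon>"
      using pos \<epsilon> by (auto simp: L_def pos_divide_le_eq)
  qed
  finally show ?thesis by (simp add: mult.commute)
qed

text \<open>Each of the at most \<open>2 ^ card \<A>\<close> atoms contributes at most
  \<open>t\<close> points.\<close>

lemma card_tiny_le:
  fixes t :: real
  assumes V: "finite V" and \<A>: "finite \<A>" and U: "U \<subseteq> V" and t: "0 \<le> t"
  shows "card {b\<in>U. card (U \<inter> atom V \<A> b) \<le> t} \<le> 2 ^ card \<A> * t"
proof -
  define \<D> where "\<D> = {D \<in> atom V \<A> ` V. card (U \<inter> D) \<le> t}"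
  have fin\<D>: "finite \<D>" unfolding \<D>_def using card_atoms_le(1)[OF \<A>] by simp
  have "card \<D> \<le> card (atom V \<A> ` V)"
    unfolding \<D>_def using card_atoms_le(1)[OF \<A>] by (intro card_mono) auto
  then have card\<D>: "card \<D> \<le> 2 ^ card \<A>" using card_atoms_le(2)[OF \<A>, of V] by linarith
  have "{b\<in>U. card (U \<inter> atom V \<A> b) \<le> t} \<subseteq> (\<Union>D\<in>\<D>. U \<inter> D)"
    unfolding \<D>_def using U mem_atom[of _ V \<A>] by auto
  then have "card {b\<in>U. card (U \<inter> atom V \<A> b) \<le> t} \<le> card (\<Union>D\<in>\<D>. U \<inter> D)"
    using fin\<D> finite_subset[OF U V] by (intro card_mono) auto
  also have "\<dots> \<le> (\<Sum>D\<in>\<D>. card (U \<inter> D))" by (rule card_UN_le[OF fin\<D>])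
  finally have "real (card {b\<in>U. card (U \<inter> atom V \<A> b) \<le> t}) \<le> (\<Sum>D\<in>\<D>. real (card (U \<inter> D)))"
    by (metis of_nat_le_iff of_nat_sum)
  also have "\<dots> \<le> card \<D> * t"
    by (rule sum_bounded_above) (auto simp: \<D>_def)
  also have "\<dots> \<le> 2 ^ card \<A> * t"
  proof (rule mult_right_mono[OF _ t])
    show "real (card \<D>) \<le> 2 ^ card \<A>"
      using card\<D> by (metis of_nat_le_iff of_nat_numeral of_nat_power)
  qed
  finally show ?thesis .
qed

text \<open>The same averaging on pairs of atoms: on a union of cells, the number of edges is the
  sum of the cell densities over its vertex pairs.\<close>

lemma card_low_density_edges_le:
  fixes \<epsilon> :: real
  assumes V: "finite V" and \<epsilon>: "0 < \<epsilon>"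
  shows "card {(x, y) \<in> R \<inter> V \<times> V. edge_density R (atom V \<A> x) (atom V \<A> y) < \<epsilon>} \<le> \<epsilon> * (card V)\<^sup>2"
proof -
  define L where "L = {(x, y) \<in> V \<times> V. edge_density R (atom V \<A> x) (atom V \<A> y) < \<epsilon>}"
  define g where "g = cell_mean (V \<times> V) (pair_profile \<A>) (\<lambda>s. of_bool (s \<in> R))"
  have fin: "finite (V \<times> V)" using V by simp
  have "real (card {(x, y) \<in> R \<inter> V \<times> V. edge_density R (atom V \<A> x) (atom V \<A> y) < \<epsilon>})
      = card ((V \<times> V) \<inter> (L \<inter> R))"
    unfolding L_def by (intro arg_cong[of _ _ "\<lambda>A. real (card A)"]) auto
  also have "\<dots> = (\<Sum>s\<in>V \<times> V. of_bool (s \<in> L) * of_bool (s \<in> R))"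
    using V by (simp add: of_bool_conj[symmetric] Collect_conj_eq del: of_bool_conj)
  also have "\<dots> = (\<Sum>s\<in>V \<times> V. of_bool (s \<in> L) * g s)"
    unfolding g_def
  proof (rule sum_mult_cell_mean[OF fin, symmetric])
    fix s t assume "s \<in> V \<times> V" "t \<in> V \<times> V" "pair_profile \<A> s = pair_profile \<A> t"
    then have "s \<in> L \<longleftrightarrow> t \<in> L"
      unfolding L_def pair_profile_def by (cases s; cases t) (simp add: atom_def)
    then show "of_bool (s \<in> L) = (of_bool (t \<in> L) :: real)" by simp
  qed
  also have "\<dots> \<le> (\<Sum>s\<in>V \<times> V. \<epsilon>)"
    using \<epsilon> by (intro sum_mono) (auto simp: L_def g_def cell_mean_pair_density[OF V])
  finally show ?thesis by (simp add: card_cartesian_product power2_eq_square mult_ac)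
qed

text \<open>
  A large matching meets some regular pair of atoms in large sets, between which the relation
  has positive density; for an induced matching there are only linearly many pairs there.
\<close>

lemma card_induced_matching_le:
  fixes \<epsilon> :: real
  assumes V: "finite V" and \<A>: "finite \<A>" and \<epsilon>: "0 < \<epsilon>"
    and M: "M \<subseteq> V \<times> V"
    and inj: "inj_on fst M" "inj_on snd M"
    and induced: "R \<inter> fst ` M \<times> snd ` M \<subseteq> N" "inj_on fst N"
    and dense: "\<And>b c. (b, c) \<in> M \<Longrightarrow> \<epsilon> \<le> edge_density R (atom V \<A> b) (atom V \<A> c)"
    and regular: "\<And>b c. (b, c) \<in> M \<Longrightarrow> \<not> irregular \<epsilon> R (atom V \<A> b) (atom V \<A> c)"
  shows "card M \<le> 2 * \<epsilon> * card V + 2 ^ card \<A> * (2 / \<epsilon>)"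
proof -
  define U where "U = fst ` M"
  define W where "W = snd ` M"
  have UV: "U \<subseteq> V" and WV: "W \<subseteq> V" unfolding U_def W_def using M by auto
  have finM: "finite M" using M V finite_subset by blast
  have finU: "finite U" unfolding U_def using finM by simp
  define U1 where "U1 = {b\<in>U. card (U \<inter> atom V \<A> b) < \<epsilon> * card (atom V \<A> b)}"
  define W1 where "W1 = {b\<in>W. card (W \<inter> atom V \<A> b) < \<epsilon> * card (atom V \<A> b)}"
  define W2 where "W2 = {b\<in>W. card (W \<inter> atom V \<A> b) \<le> 2 / \<epsilon>}"
  have cover: "M \<subseteq> {s\<in>M. fst s \<in> U1} \<union> {s\<in>M. snd s \<in> W1} \<union> {s\<in>M. snd s \<in> W2}"
  proof
    fix s assume sM: "s \<in> M"
    obtain b c where s: "s = (b, c)" by (cases s)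
    define C where "C = atom V \<A> b"
    define D where "D = atom V \<A> c"
    define X where "X = U \<inter> C"
    define Y where "Y = W \<inter> D"
    have bU: "b \<in> U" "c \<in> W" unfolding U_def W_def using sM s by force+
    \<comment> \<open>Regularity forces at least \<open>\<epsilon> / 2 * (card X * card Y)\<close>
      edges between large sets, while the induced matching allows at most \<open>card X\<close>.
      Hence every matching edge has a sparse endpoint or a tiny second side.\<close>
    have "card Y \<le> 2 / \<epsilon>" if X: "\<not> card X < \<epsilon> * card C" and Y: "\<not> card Y < \<epsilon> * card D"
    proof -
      have d: "\<epsilon> \<le> edge_density R C D" and "\<not> irregular \<epsilon> R C D"
        using dense regular sM unfolding s C_def D_def by auto
      with X Y have "\<not> card (R \<inter> X \<times> Y) < edge_density R C D / 2 * (card X * card Y)"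
        unfolding irregular_def X_def Y_def by (auto simp: not_less)
      then have "edge_density R C D / 2 * (card X * card Y) \<le> card (R \<inter> X \<times> Y)" by simp
      moreover have "card (R \<inter> X \<times> Y) \<le> card X"
      proof -
        have "inj_on fst (R \<inter> X \<times> Y)"
          using induced unfolding X_def Y_def U_def W_def by (blast intro: inj_on_subset)
        moreover have "fst ` (R \<inter> X \<times> Y) \<subseteq> X" by auto
        ultimately show ?thesis
          using finU unfolding X_def by (intro card_inj_on_le) auto
      qed
      moreover have "\<epsilon> / 2 * (card X * card Y) \<le> edge_density R C D / 2 * (card X * card Y)"
        using d by (intro mult_right_mono) auto
      ultimately have "card X * (\<epsilon> / 2 * card Y) \<le> card X * (1::real)"
        by (simp add: mult_ac)
      moreover have "b \<in> X" unfolding X_def C_def using bU UV mem_atom[of b V \<A>] by auto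
      then have "0 < real (card X)" using finU unfolding X_def by (auto simp: card_gt_0_iff)
      ultimately have "\<epsilon> / 2 * card Y \<le> 1" by (simp only: mult_le_cancel_left_pos)
      then show ?thesis using \<epsilon> by (simp add: field_simps)
    qed
    then show "s \<in> {s\<in>M. fst s \<in> U1} \<union> {s\<in>M. snd s \<in> W1} \<union> {s\<in>M. snd s \<in> W2}"
      using sM bU unfolding s U1_def W1_def W2_def X_def Y_def C_def D_def by auto
  qed
  have le: "card {s\<in>M. h s \<in> A} \<le> card A" if "inj_on h M" "A \<subseteq> h ` M" for h :: "'a \<times> 'a \<Rightarrow> 'a" and A
  proof (rule card_inj_on_le)
    show "inj_on h {s\<in>M. h s \<in> A}" using that(1) by (rule inj_on_subset) auto
    show "finite A" using that(2) finM finite_surj by blast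
  qed auto
  have "card M \<le> card ({s\<in>M. fst s \<in> U1} \<union> {s\<in>M. snd s \<in> W1} \<union> {s\<in>M. snd s \<in> W2})"
    using cover finM by (intro card_mono) auto
  also have "\<dots> \<le> card {s\<in>M. fst s \<in> U1} + card {s\<in>M. snd s \<in> W1} + card {s\<in>M. snd s \<in> W2}"
    by (meson add_mono card_Un_le order_refl order_trans)
  also have "\<dots> \<le> card U1 + card W1 + card W2"
    by (intro add_mono le inj) (auto simp: U1_def W1_def W2_def U_def W_def)
  finally have "real (card M) \<le> card U1 + card W1 + card W2" by linarith
  moreover have "card U1 \<le> \<epsilon> * card V" "card W1 \<le> \<epsilon> * card V"
    unfolding U1_def W1_def using card_sparse_le[OF V _ \<epsilon>] UV WV by auto
  moreover have "card W2 \<le> 2 ^ card \<A> * (2 / \<epsilon>)"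
    unfolding W2_def using \<epsilon> by (intro card_tiny_le[OF V \<A> WV]) auto
  ultimately show ?thesis by linarith
qed

section \<open>The (6,3) theorem for tripartite systems of triples\<close>

text \<open>The first three clauses exclude two edges sharing a pair, one clause for each pair of
  coordinates. The last excludes the loose triangle with corners a, b, c'; concluding
  \<open>c = c'\<close> leaves room for the degenerate case in which all three triples
  coincide.\<close>

definition tripartite_RS_free :: "('a \<times> 'a \<times> 'a) set \<Rightarrow> bool" where
  "tripartite_RS_free T \<longleftrightarrow>
     (\<forall>a b c c'. (a, b, c) \<in> T \<longrightarrow> (a, b, c') \<in> T \<longrightarrow> c = c') \<and>
     (\<forall>a b b' c. (a, b, c) \<in> T \<longrightarrow> (a, b', c) \<in> T \<longrightarrow> b = b') \<and>
     (\<forall>a a' b c. (a, b, c) \<in> T \<longrightarrow> (a', b, c) \<in> T \<longrightarrow> a = a') \<and>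
     (\<forall>a a' b b' c c'. (a, b, c) \<in> T \<longrightarrow> (a, b', c') \<in> T \<longrightarrow> (a', b, c') \<in> T \<longrightarrow> c = c')"

text \<open>Dropping the first coordinate is injective on \<open>T\<close>, and the links of the
  first coordinates split the resulting relation \<open>R\<close> into induced matchings. Apart from
  edges in sparse or irregular pairs of atoms, each matching is only a small multiple of
  \<open>card V\<close>.\<close>

lemma card_tripartite_RS_free_le:
  fixes \<epsilon> :: real
  assumes \<epsilon>: "0 < \<epsilon>"
  obtains n0 where "\<And>(V :: 'a set) T. \<lbrakk>finite V; n0 \<le> card V; T \<subseteq> V \<times> V \<times> V;
      tripartite_RS_free T\<rbrakk> \<Longrightarrow> card T \<le> \<epsilon> * (card V)\<^sup>2"
proof -
  \<comment> \<open>The five shares: one for low density, one for irregular pairs, and three for the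
    matchings.\<close>
  define \<delta> where "\<delta> = \<epsilon> / 5"
  have \<delta>: "0 < \<delta>" unfolding \<delta>_def using \<epsilon> by simp
  obtain M where M: "\<And>(V :: 'a set) R. finite V \<Longrightarrow>
      \<exists>\<A>. finite \<A> \<and> card \<A> \<le> M \<and> card (irregular_pairs \<delta> V R \<A>) \<le> \<delta> * (card V)\<^sup>2"
    using regularity[OF \<delta>] by blast
  \<comment> \<open>Chosen so that the constant term of the matching bound is at most
    \<open>\<delta> * card V\<close>, the third share of each matching.\<close>
  obtain n0 :: nat where n0: "2 ^ M * (2 / \<delta>) / \<delta> \<le> n0"
    using real_arch_simple by blast
  show thesis
  proof (rule that[of n0])
    fix V :: "'a set" and T
    assume V: "finite V" and n: "n0 \<le> card V" and TV: "T \<subseteq> V \<times> V \<times> V"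
      and free: "tripartite_RS_free T"
    have P1: "\<And>a b c c'. (a, b, c) \<in> T \<Longrightarrow> (a, b, c') \<in> T \<Longrightarrow> c = c'"
      and P2: "\<And>a b b' c. (a, b, c) \<in> T \<Longrightarrow> (a, b', c) \<in> T \<Longrightarrow> b = b'"
      and P3: "\<And>a a' b c. (a, b, c) \<in> T \<Longrightarrow> (a', b, c) \<in> T \<Longrightarrow> a = a'"
      and P4: "\<And>a a' b b' c c'. (a, b, c) \<in> T \<Longrightarrow> (a, b', c') \<in> T \<Longrightarrow> (a', b, c') \<in> T \<Longrightarrow> c = c'"
      using free unfolding tripartite_RS_free_def by blast+
    define R where "R = snd ` T"
    obtain \<A> where \<A>: "finite \<A>" "card \<A> \<le> M"
      and irr: "card (irregular_pairs \<delta> V R \<A>) \<le> \<delta> * (card V)\<^sup>2"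
      using M[OF V] by blast
    have finT: "finite T" using TV V finite_subset by blast
    have injT: "inj_on snd T" using P3 by (auto simp: inj_on_def)
    have RV: "R \<subseteq> V \<times> V" unfolding R_def using TV by auto
    then have finR: "finite R" using V finite_subset by blast
    define Low where "Low = {(x, y) \<in> R \<inter> V \<times> V. edge_density R (atom V \<A> x) (atom V \<A> y) < \<delta>}"
    define I where "I = irregular_pairs \<delta> V R \<A>"
    define Good where "Good a = {s \<in> R - Low - I. (a, s) \<in> T}" for a
    have finI: "finite I" unfolding I_def irregular_pairs_def
      by (rule finite_subset[of _ "V \<times> V"]) (use V in auto)
    have finLow: "finite Low" unfolding Low_def by (rule finite_subset[OF _ finR]) auto
    have Good: "card (Good a) \<le> 3 * \<delta> * card V" for a
    proof -
      have "card (Good a) \<le> 2 * \<delta> * card V + 2 ^ card \<A> * (2 / \<delta>)"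
      proof (rule card_induced_matching_le[OF V \<A>(1) \<delta>, where N = "{s. (a, s) \<in> T}" and R = R])
        show "Good a \<subseteq> V \<times> V" unfolding Good_def using RV by auto
        show "inj_on fst (Good a)" "inj_on fst {s. (a, s) \<in> T}"
          unfolding Good_def using P1 by (auto simp: inj_on_def)
        show "inj_on snd (Good a)"
          unfolding Good_def using P2 by (auto simp: inj_on_def)
        show "R \<inter> fst ` Good a \<times> snd ` Good a \<subseteq> {s. (a, s) \<in> T}"
        proof
          fix s assume s: "s \<in> R \<inter> fst ` Good a \<times> snd ` Good a"
          obtain b c' where bc: "s = (b, c')" by (cases s)
          \<comment> \<open>An edge of \<open>R\<close> from \<open>b\<close> to \<open>c'\<close>
            comes from some triple \<open>(a', b, c')\<close>, which would close a loose triangle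
            with the two triples through \<open>a\<close> unless \<open>c = c'\<close>.\<close>
          from s obtain a' b' c where "(a', b, c') \<in> T" and 1: "(a, b, c) \<in> T" and "(a, b', c') \<in> T"
            unfolding bc R_def Good_def by auto
          then have "c = c'" using P4 by blast
          then show "s \<in> {s. (a, s) \<in> T}" using 1 bc by simp
        qed
        show "\<delta> \<le> edge_density R (atom V \<A> b) (atom V \<A> c)" if "(b, c) \<in> Good a" for b c
          using that RV unfolding Good_def Low_def by auto
        show "\<not> irregular \<delta> R (atom V \<A> b) (atom V \<A> c)" if "(b, c) \<in> Good a" for b c
          using that RV unfolding Good_def I_def irregular_pairs_def by auto
      qed
      moreover have "2 ^ card \<A> * (2 / \<delta>) \<le> 2 ^ M * (2 / \<delta>)"
        using \<A>(2) \<delta> by (intro mult_right_mono power_increasing) auto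
      moreover have "2 ^ M * (2 / \<delta>) \<le> \<delta> * card V"
      proof -
        have "2 ^ M * (2 / \<delta>) / \<delta> \<le> card V" using n0 n by linarith
        then show ?thesis using \<delta> by (simp only: pos_divide_le_eq mult.commute)
      qed
      ultimately show ?thesis by linarith
    qed
    have "card T = card R" unfolding R_def by (rule card_image[OF injT, symmetric])
    also have "\<dots> \<le> card (Low \<union> I \<union> (\<Union>a\<in>V. Good a))"
    proof (rule card_mono)
      show "finite (Low \<union> I \<union> (\<Union>a\<in>V. Good a))"
        using V finR finI finLow unfolding Good_def by auto
      show "R \<subseteq> Low \<union> I \<union> (\<Union>a\<in>V. Good a)"
        unfolding Good_def using TV by (fastforce simp: R_def)
    qed
    also have "\<dots> \<le> card Low + card I + (\<Sum>a\<in>V. card (Good a))"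
      using card_Un_le[of "Low \<union> I" "\<Union>a\<in>V. Good a"] card_Un_le[of Low I] card_UN_le[OF V, of Good]
      by linarith
    finally have "real (card T) \<le> card Low + card I + (\<Sum>a\<in>V. real (card (Good a)))"
      by (metis of_nat_add of_nat_le_iff of_nat_sum)
    also have "\<dots> \<le> \<delta> * (card V)\<^sup>2 + \<delta> * (card V)\<^sup>2 + card V * (3 * \<delta> * card V)"
      unfolding Low_def I_def of_nat_add
      by (intro add_mono card_low_density_edges_le[OF V \<delta>] irr sum_bounded_above Good)
    also have "\<dots> = \<epsilon> * (card V)\<^sup>2"
      unfolding \<delta>_def by (simp add: power2_eq_square)
    finally show "card T \<le> \<epsilon> * (card V)\<^sup>2" .
  qed
qed

section \<open>Ordered 3-graphs\<close>

text \<open>The rank counts strict predecessors. Replacing the abstract order by natural numbers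
  lets blocks be cut by integer division.\<close>

lemma linear_order_rank:
  assumes V: "finite V" and lin: "linear_order_on V r"
  obtains \<rho> :: "'a \<Rightarrow> nat" where "inj_on \<rho> V" "\<And>x. x \<in> V \<Longrightarrow> \<rho> x < card V"
    "\<And>x y. x \<in> V \<Longrightarrow> y \<in> V \<Longrightarrow> (x, y) \<in> r \<longleftrightarrow> \<rho> x \<le> \<rho> y"
proof -
  have rfl: "(x, x) \<in> r" if "x \<in> V" for x
    using lin that by (auto simp: order_on_defs refl_on_def)
  have asym: "x = y" if "(x, y) \<in> r" "(y, x) \<in> r" for x y
    using lin that by (auto simp: order_on_defs antisym_def)
  have tr: "(x, z) \<in> r" if "(x, y) \<in> r" "(y, z) \<in> r" for x y z
    using lin that unfolding order_on_defs trans_def by blast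
  have tot: "(x, y) \<in> r \<or> (y, x) \<in> r" if "x \<in> V" "y \<in> V" for x y
    using lin that rfl by (cases "x = y") (auto simp: order_on_defs total_on_def)
  define B where "B x = {y\<in>V. (y, x) \<in> r \<and> y \<noteq> x}" for x
  define \<rho> where "\<rho> x = card (B x)" for x
  have less: "\<rho> x < \<rho> y" if "x \<in> V" "(x, y) \<in> r" "x \<noteq> y" for x y
  proof -
    have "B x \<subset> B y"
      using that tr asym unfolding B_def by blast
    then show ?thesis
      unfolding \<rho>_def by (intro psubset_card_mono) (simp_all add: B_def V)
  qed
  have "inj_on \<rho> V"
    by (rule inj_onI) (metis less less_irrefl tot)
  moreover have "\<rho> x < card V" if "x \<in> V" for x
    unfolding \<rho>_def using that V by (intro psubset_card_mono) (auto simp: B_def)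
  moreover have "(x, y) \<in> r \<longleftrightarrow> \<rho> x \<le> \<rho> y" if "x \<in> V" "y \<in> V" for x y
    by (metis less less_imp_le not_le order_refl tot that)
  ultimately show thesis by (rule that)
qed

lemma hypergraph_iso_I2:
  assumes "distinct [p, q, r, s]"
  shows "hypergraph_iso I2 \<lparr>verts = {p, q, r, s}, edges = {{p, q, r}, {p, q, s}}\<rparr>"
  unfolding hypergraph_iso_def
proof (intro exI conjI)
  let ?\<phi> = "\<lambda>i. [p, q, r, s] ! i"
  show "bij_betw ?\<phi> (verts I2) (verts \<lparr>verts = {p, q, r, s}, edges = {{p, q, r}, {p, q, s}}\<rparr>)"
    using assms by (auto simp: bij_betw_def inj_on_def I2_def)
  show "edges \<lparr>verts = {p, q, r, s}, edges = {{p, q, r}, {p, q, s}}\<rparr> = (\<lambda>e. ?\<phi> ` e) ` edges I2"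
    by (simp add: I2_def)
qed

lemma hypergraph_iso_T3:
  assumes "distinct [p, q, r, s, t, u]"
  shows "hypergraph_iso T3
    \<lparr>verts = {p, q, r, s, t, u}, edges = {{p, q, r}, {r, s, t}, {t, u, p}}\<rparr>" (is "hypergraph_iso _ ?G")
  unfolding hypergraph_iso_def
proof (intro exI conjI)
  let ?\<phi> = "\<lambda>i. [p, q, r, s, t, u] ! i"
  show "bij_betw ?\<phi> (verts T3) (verts ?G)"
    using assms by (auto simp: bij_betw_def inj_on_def T3_def)
  show "edges ?G = (\<lambda>e. ?\<phi> ` e) ` edges T3"
    by (simp add: T3_def)
qed

section \<open>Forbidden copies in an ordered 3-graph with ranks\<close>

locale ranked_three_graph =
  fixes H :: "nat ordered_hypergraph" and \<rho> :: "nat \<Rightarrow> nat"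
  assumes ordered: "ordered_three_graph H"
    and inj_rank: "inj_on \<rho> (verts H)"
    and rank_less: "\<And>x. x \<in> verts H \<Longrightarrow> \<rho> x < card (verts H)"
    and vle_iff: "\<And>x y. x \<in> verts H \<Longrightarrow> y \<in> verts H \<Longrightarrow> (x, y) \<in> vle H \<longleftrightarrow> \<rho> x \<le> \<rho> y"
    and free: "\<And>G. G \<in> ord_family F_RS \<Longrightarrow> \<not> contains H G"
begin

text \<open>Listing each edge in increasing rank makes the coordinates available as the three
  parts.\<close>

definition triples :: "(nat \<times> nat \<times> nat) set" where
  "triples = {(x, y, z) \<in> verts H \<times> verts H \<times> verts H. \<rho> x < \<rho> y \<and> \<rho> y < \<rho> z \<and> {x, y, z} \<in> edges H}"

lemma triplesD:
  assumes "(x, y, z) \<in> triples"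
  shows "x \<in> verts H" "y \<in> verts H" "z \<in> verts H" "\<rho> x < \<rho> y" "\<rho> y < \<rho> z" "{x, y, z} \<in> edges H"
  using assms by (auto simp: triples_def)

text \<open>Restrict the order to the union of the three sets. They need not be intervals in
  \<open>H\<close>, but they are intervals in the restriction, where no other vertices remain; the
  identity then embeds this copy in \<open>H\<close>.\<close>

lemma no_tripartite_copy:
  assumes sub: "J1 \<subseteq> verts H" "J2 \<subseteq> verts H" "J3 \<subseteq> verts H"
    and less12: "\<And>x y. x \<in> J1 \<Longrightarrow> y \<in> J2 \<Longrightarrow> \<rho> x < \<rho> y"
    and less23: "\<And>x y. x \<in> J2 \<Longrightarrow> y \<in> J3 \<Longrightarrow> \<rho> x < \<rho> y"
    and ne: "J2 \<noteq> {}"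
    and E: "E \<subseteq> triples" "E \<subseteq> J1 \<times> J2 \<times> J3"
    and F: "F \<in> F_RS"
    and iso: "hypergraph_iso F
      \<lparr>verts = J1 \<union> J2 \<union> J3, edges = (\<lambda>(x, y, z). {x, y, z}) ` E\<rparr>"
  shows False
proof -
  define ES where "ES = (\<lambda>(x, y, z). {x, y, z}) ` E"
  have ES: "ES \<subseteq> edges H"
    unfolding ES_def using E(1) by (auto dest: triplesD(6))
  have partite: "\<exists>x\<in>J1. \<exists>y\<in>J2. \<exists>z\<in>J3. e = {x, y, z}" if "e \<in> ES" for e
    using that E(2) unfolding ES_def by fast
  define W where "W = J1 \<union> J2 \<union> J3"
  define G :: "nat ordered_hypergraph"
    where "G = \<lparr>verts = W, edges = ES, vle = {(x, y) \<in> W \<times> W. \<rho> x \<le> \<rho> y}\<rparr>"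
  \<comment> \<open>Transitivity passes through an element of \<open>J2\<close>, hence the
    nonemptiness assumption.\<close>
  have less13: "\<rho> x < \<rho> y" if "x \<in> J1" "y \<in> J3" for x y
    using ne less12 less23 that by (meson ex_in_conv less_trans)
  have disj: "J1 \<inter> J2 = {}" "J2 \<inter> J3 = {}" "J1 \<inter> J3 = {}"
    using less12 less23 less13 by (metis disjoint_iff less_irrefl)+
  have WV: "W \<subseteq> verts H" unfolding W_def using sub by auto
  have finV: "finite (verts H)" and H3: "\<And>e. e \<in> edges H \<Longrightarrow> card e = 3"
    using ordered by (auto simp: ordered_three_graph_def three_graph_def)
  have inj: "x = y" if "x \<in> W" "y \<in> W" "\<rho> x = \<rho> y" for x y
    using inj_rank WV that by (auto dest: inj_onD)
  have "linear_order_on W {(x, y) \<in> W \<times> W. \<rho> x \<le> \<rho> y}"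
    using inj by (auto simp: order_on_defs refl_on_def trans_def antisym_def total_on_def)
  moreover have "e \<subseteq> W" if "e \<in> ES" for e
    using partite[OF that] unfolding W_def by auto
  ultimately have "ordered_three_graph G"
    using finite_subset[OF WV finV] ES H3
    by (auto simp: ordered_three_graph_def three_graph_def G_def)
  moreover have "interval_three_partite G"
    unfolding interval_three_partite_def
  proof (intro exI conjI ballI)
    show "is_interval_of G J1" "is_interval_of G J2" "is_interval_of G J3"
      unfolding is_interval_of_def G_def W_def using less12 less23 less13
      by (auto simp: not_le[symmetric])
    show "set_precedes G J1 J2" "set_precedes G J2 J3" "set_precedes G J1 J3"
      unfolding set_precedes_def G_def W_def
      using less12 less23 less13 disj by (auto intro: less_imp_le)
    fix e assume "e \<in> edges G"
    then obtain x y z where e: "e = {x, y, z}" and xyz: "x \<in> J1" "y \<in> J2" "z \<in> J3"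
      using partite[of e] unfolding G_def by auto
    have "e \<inter> J1 = {x}" "e \<inter> J2 = {y}" "e \<inter> J3 = {z}"
      unfolding e using xyz disj by auto
    then show "card (e \<inter> J1) = 1" "card (e \<inter> J2) = 1" "card (e \<inter> J3) = 1" by simp_all
  qed
  moreover have "hypergraph_iso F G"
    using iso by (simp add: hypergraph_iso_def G_def W_def ES_def)
  ultimately have "G \<in> ord_family F_RS"
    using F by (auto simp: ord_family_def ord_graph_def)
  moreover have "contains H G"
    unfolding contains_def
  proof (intro exI conjI ballI impI)
    fix x y assume "x \<in> verts G" "y \<in> verts G" "(x, y) \<in> vle G"
    then show "(id x, id y) \<in> vle H"
      using vle_iff[of x y] WV by (auto simp: G_def)
  qed (use WV ES in \<open>auto simp: G_def\<close>)
  ultimately show False using free by blast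
qed

lemma finite_verts: "finite (verts H)"
  using ordered by (simp add: ordered_three_graph_def three_graph_def)

lemma finite_triples: "finite triples"
  by (rule finite_subset[of _ "verts H \<times> verts H \<times> verts H"]) (auto simp: triples_def finite_verts)

lemma card_edges_le_triples: "card (edges H) \<le> card triples"
proof -
  have "edges H \<subseteq> (\<lambda>(x, y, z). {x, y, z}) ` triples"
  proof
    fix e assume e: "e \<in> edges H"
    then have "card e = 3" and eV: "e \<subseteq> verts H"
      using ordered by (auto simp: ordered_three_graph_def three_graph_def)
    then obtain u v w where uvw: "e = {u, v, w}" "u \<noteq> v" "u \<noteq> w" "v \<noteq> w"
      by (auto simp: card_3_iff)
    then have "\<rho> u \<noteq> \<rho> v" "\<rho> u \<noteq> \<rho> w" "\<rho> v \<noteq> \<rho> w"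
      using inj_rank eV by (auto dest: inj_onD)
    then consider "\<rho> u < \<rho> v \<and> \<rho> v < \<rho> w" | "\<rho> u < \<rho> w \<and> \<rho> w < \<rho> v" | "\<rho> v < \<rho> u \<and> \<rho> u < \<rho> w"
      | "\<rho> v < \<rho> w \<and> \<rho> w < \<rho> u" | "\<rho> w < \<rho> u \<and> \<rho> u < \<rho> v" | "\<rho> w < \<rho> v \<and> \<rho> v < \<rho> u"
      by linarith
    then have "\<exists>x y z. e = {x, y, z} \<and> \<rho> x < \<rho> y \<and> \<rho> y < \<rho> z"
      unfolding uvw(1) by cases (metis insert_commute)+
    then obtain x y z where "e = {x, y, z}" "\<rho> x < \<rho> y" "\<rho> y < \<rho> z" by blast
    then have "(x, y, z) \<in> triples" "e = {x, y, z}"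
      using e eV unfolding triples_def by auto
    then show "e \<in> (\<lambda>(x, y, z). {x, y, z}) ` triples" by force
  qed
  then show ?thesis
    using finite_triples by (meson surj_card_le)
qed

text \<open>Both \<open>c\<close> and \<open>c'\<close> come after \<open>b\<close>, so
  \<open>{a}\<close>, \<open>{b}\<close>, \<open>{c, c'}\<close> are the parts of an interval copy
  of \<open>I2\<close>, whichever of \<open>c\<close> and \<open>c'\<close> is first.\<close>

lemma triples_unique3:
  assumes "(a, b, c) \<in> triples" "(a, b, c') \<in> triples"
  shows "c = c'"
proof (rule ccontr)
  assume ne: "c \<noteq> c'"
  note d = triplesD[OF assms(1)] triplesD[OF assms(2)]
  have "hypergraph_iso I2 \<lparr>verts = {a, b, c, c'}, edges = {{a, b, c}, {a, b, c'}}\<rparr>"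
    by (rule hypergraph_iso_I2) (use ne d in auto)
  moreover have "{a, b, c, c'} = {a} \<union> {b} \<union> {c, c'}" by auto
  ultimately have "hypergraph_iso I2
      \<lparr>verts = {a} \<union> {b} \<union> {c, c'}, edges = (\<lambda>(x, y, z). {x, y, z}) ` {(a, b, c), (a, b, c')}\<rparr>"
    by simp
  then show False
    by (rule no_tripartite_copy[rotated -1]) (use d assms in \<open>auto simp: F_RS_def\<close>)
qed

lemma triples_unique1:
  assumes "(a, b, c) \<in> triples" "(a', b, c) \<in> triples"
  shows "a = a'"
proof (rule ccontr)
  assume ne: "a \<noteq> a'"
  note d = triplesD[OF assms(1)] triplesD[OF assms(2)]
  have "hypergraph_iso I2 \<lparr>verts = {b, c, a, a'}, edges = {{b, c, a}, {b, c, a'}}\<rparr>"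
    by (rule hypergraph_iso_I2) (use ne d in auto)
  moreover have "{b, c, a, a'} = {a, a'} \<union> {b} \<union> {c}" "{b, c, a} = {a, b, c}" "{b, c, a'} = {a', b, c}"
    by auto
  ultimately have "hypergraph_iso I2
      \<lparr>verts = {a, a'} \<union> {b} \<union> {c}, edges = (\<lambda>(x, y, z). {x, y, z}) ` {(a, b, c), (a', b, c)}\<rparr>"
    by simp
  then show False
    by (rule no_tripartite_copy[rotated -1]) (use d assms in \<open>auto simp: F_RS_def\<close>)
qed

text \<open>Here the shared pair is the outer one: \<open>b\<close> and \<open>b'\<close> both lie
  strictly between \<open>a\<close> and \<open>c\<close>, so they form the middle part.\<close>

lemma triples_unique2:
  assumes "(a, b, c) \<in> triples" "(a, b', c) \<in> triples"
  shows "b = b'"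
proof (rule ccontr)
  assume ne: "b \<noteq> b'"
  note d = triplesD[OF assms(1)] triplesD[OF assms(2)]
  have "hypergraph_iso I2 \<lparr>verts = {a, c, b, b'}, edges = {{a, c, b}, {a, c, b'}}\<rparr>"
    by (rule hypergraph_iso_I2) (use ne d in auto)
  moreover have "{a, c, b, b'} = {a} \<union> {b, b'} \<union> {c}" "{a, c, b} = {a, b, c}" "{a, c, b'} = {a, b', c}"
    by auto
  ultimately have "hypergraph_iso I2
      \<lparr>verts = {a} \<union> {b, b'} \<union> {c}, edges = (\<lambda>(x, y, z). {x, y, z}) ` {(a, b, c), (a, b', c)}\<rparr>"
    by simp
  then show False
    by (rule no_tripartite_copy[rotated -1]) (use d assms in \<open>auto simp: F_RS_def\<close>)
qed

text \<open>The two rank hypotheses are exactly the comparisons, not given by the edges themselves,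
  that place \<open>{a, a'}\<close> before \<open>{b, b'}\<close> before
  \<open>{c, c'}\<close>.\<close>

lemma triples_no_triangle:
  assumes "(a, b, c) \<in> triples" "(a, b', c') \<in> triples" "(a', b, c') \<in> triples"
    and less: "\<rho> a' < \<rho> b'" "\<rho> b' < \<rho> c"
  shows "c = c'"
proof (rule ccontr)
  assume ne: "c \<noteq> c'"
  note d = triplesD[OF assms(1)] triplesD[OF assms(2)] triplesD[OF assms(3)]
  \<comment> \<open>If either pair coincided, two of the triples would be \<open>(a, b, c)\<close>
    and \<open>(a, b, c')\<close>, forcing \<open>c = c'\<close>.\<close>
  have ne': "a \<noteq> a'" "b \<noteq> b'"
    using triples_unique3 assms ne by blast+
  have "hypergraph_iso T3 \<lparr>verts = {b, c, a, b', c', a'}, edges = {{b, c, a}, {a, b', c'}, {c', a', b}}\<rparr>"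
    by (rule hypergraph_iso_T3) (use ne ne' d less in auto)
  moreover have "{b, c, a, b', c', a'} = {a, a'} \<union> {b, b'} \<union> {c, c'}" "{b, c, a} = {a, b, c}"
    "{c', a', b} = {a', b, c'}" by auto
  ultimately have "hypergraph_iso T3 \<lparr>verts = {a, a'} \<union> {b, b'} \<union> {c, c'},
      edges = (\<lambda>(x, y, z). {x, y, z}) ` {(a, b, c), (a, b', c'), (a', b, c')}\<rparr>"
    by simp
  then show False
    by (rule no_tripartite_copy[rotated -1]) (use d less assms in \<open>auto simp: F_RS_def\<close>)
qed

section \<open>Cutting the order into blocks\<close>

text \<open>The quotient \<open>\<rho> x div L\<close> is the index of the block of \<open>L\<close>
  consecutive ranks containing \<open>x\<close>.\<close>

definition close_pairs :: "nat \<Rightarrow> (nat \<times> nat) set" where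
  "close_pairs L = {(x, y) \<in> verts H \<times> verts H. \<rho> x div L = \<rho> y div L}"

lemma card_close_pairs_le:
  assumes "0 < L"
  shows "finite (close_pairs L)" "card (close_pairs L) \<le> card (verts H) * L"
proof -
  have eq: "close_pairs L = Sigma (verts H) (\<lambda>x. {y \<in> verts H. \<rho> x div L = \<rho> y div L})"
    by (auto simp: close_pairs_def)
  show "finite (close_pairs L)" unfolding eq using finite_verts by auto
  have "card {y \<in> verts H. q = \<rho> y div L} \<le> L" for q
  proof -
    have "card {y \<in> verts H. q = \<rho> y div L} \<le> card {q * L..<q * L + L}"
    proof (rule card_inj_on_le)
      show "inj_on \<rho> {y \<in> verts H. q = \<rho> y div L}"
        using inj_rank by (rule inj_on_subset) auto
      show "\<rho> ` {y \<in> verts H. q = \<rho> y div L} \<subseteq> {q * L..<q * L + L}"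
        using assms by (auto simp: dividend_less_div_times add.commute)
    qed simp
    then show ?thesis by simp
  qed
  then have "(\<Sum>x\<in>verts H. card {y \<in> verts H. \<rho> x div L = \<rho> y div L}) \<le> card (verts H) * L"
    using sum_bounded_above[of "verts H" _ L] by simp
  then show "card (close_pairs L) \<le> card (verts H) * L"
    unfolding eq using finite_verts by simp
qed

text \<open>
  A triple whose first two or last two vertices share a block is determined by that close pair;
  the remaining triples split according to their three blocks into tripartite pieces.
\<close>

lemma card_triples_le:
  fixes B :: real
  assumes L: "0 < L" and K: "card (verts H) \<le> K * L"
    and piece: "\<And>i j k. i < j \<Longrightarrow> j < k \<Longrightarrow>
      card {(x, y, z) \<in> triples. \<rho> x div L = i \<and> \<rho> y div L = j \<and> \<rho> z div L = k} \<le> B"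
    and B: "0 \<le> B"
  shows "card triples \<le> 2 * real (card (verts H)) * L + real K ^ 3 * B"
proof -
  define T1 where "T1 = {(x, y, z) \<in> triples. \<rho> x div L = \<rho> y div L}"
  define T2 where "T2 = {(x, y, z) \<in> triples. \<rho> y div L = \<rho> z div L}"
  \<comment> \<open>With \<open>i < j\<close> and \<open>j < k\<close> built in, index triples that
    are not increasing give empty pieces, so the union may run over the whole cube
    \<open>Q\<close>.\<close>
  define P where "P = (\<lambda>(i, j, k). {(x, y, z) \<in> triples. i < j \<and> j < k \<and>
     \<rho> x div L = i \<and> \<rho> y div L = j \<and> \<rho> z div L = k})"
  define Q where "Q = {..<K} \<times> {..<K} \<times> {..<K}"
  have finQ: "finite Q" unfolding Q_def by simp
  have "card T1 \<le> card (close_pairs L)"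
  proof (rule card_inj_on_le[where f = "\<lambda>(x, y, z). (x, y)"])
    show "inj_on (\<lambda>(x, y, z). (x, y)) T1"
      unfolding T1_def inj_on_def using triples_unique3 by auto
    show "(\<lambda>(x, y, z). (x, y)) ` T1 \<subseteq> close_pairs L"
      unfolding T1_def close_pairs_def by (auto dest: triplesD)
  qed (rule card_close_pairs_le[OF L])
  moreover have "card T2 \<le> card (close_pairs L)"
  proof (rule card_inj_on_le[where f = "\<lambda>(x, y, z). (y, z)"])
    show "inj_on (\<lambda>(x, y, z). (y, z)) T2"
      unfolding T2_def inj_on_def using triples_unique1 by auto
    show "(\<lambda>(x, y, z). (y, z)) ` T2 \<subseteq> close_pairs L"
      unfolding T2_def close_pairs_def by (auto dest: triplesD)
  qed (rule card_close_pairs_le[OF L])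
  ultimately have T12: "card T1 + card T2 \<le> 2 * (card (verts H) * L)"
    using card_close_pairs_le(2)[OF L] by linarith
  have PB: "card (P q) \<le> B" for q
  proof (cases q)
    case (fields i j k)
    show ?thesis
    proof (cases "i < j \<and> j < k")
      case True
      then show ?thesis using piece[of i j k] by (simp add: P_def fields)
    next
      case False
      then have "P q = {}" by (auto simp: P_def fields)
      then show ?thesis using B by simp
    qed
  qed
  have cover: "triples \<subseteq> T1 \<union> T2 \<union> (\<Union>q\<in>Q. P q)"
  proof
    fix t assume t: "t \<in> triples"
    obtain x y z where xyz: "t = (x, y, z)" by (cases t)
    note d = triplesD[OF t[unfolded xyz]]
    \<comment> \<open>Ranks are below \<open>K * L\<close>, so only \<open>K\<close> block indices
      occur. They increase weakly along a triple: either two neighbouring ones agree, or all three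
      are distinct.\<close>
    have "\<rho> v div L < K" if "v \<in> verts H" for v
      using rank_less[OF that] K by (intro less_mult_imp_div_less) auto
    moreover have "\<rho> x div L \<le> \<rho> y div L" "\<rho> y div L \<le> \<rho> z div L"
      using d by (auto intro: div_le_mono)
    moreover have "(x, y, z) \<in> P (\<rho> x div L, \<rho> y div L, \<rho> z div L)"
      if "\<rho> x div L < \<rho> y div L" "\<rho> y div L < \<rho> z div L"
      using that t by (simp add: P_def xyz)
    ultimately show "t \<in> T1 \<union> T2 \<union> (\<Union>q\<in>Q. P q)"
      using t d(1-3) unfolding xyz T1_def T2_def Q_def by (fastforce simp: le_less)
  qed
  have "finite (P q)" "finite T1" "finite T2" for q
    unfolding P_def T1_def T2_def
    by (auto split: prod.splits intro!: finite_subset[OF _ finite_triples])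
  then have "finite (T1 \<union> T2 \<union> (\<Union>q\<in>Q. P q))"
    using finQ by (intro finite_UnI finite_UN_I)
  then have "card triples \<le> card (T1 \<union> T2 \<union> (\<Union>q\<in>Q. P q))"
    using cover by (rule card_mono)
  also have "\<dots> \<le> card T1 + card T2 + (\<Sum>q\<in>Q. card (P q))"
    using card_Un_le[of "T1 \<union> T2" "\<Union>q\<in>Q. P q"] card_Un_le[of T1 T2] card_UN_le[OF finQ, of P]
    by linarith
  finally have "real (card triples) \<le> real (card T1 + card T2) + (\<Sum>q\<in>Q. real (card (P q)))"
    by (metis of_nat_add of_nat_le_iff of_nat_sum)
  also have "\<dots> \<le> real (2 * (card (verts H) * L)) + card Q * B"
    using T12 by (intro add_mono sum_bounded_above PB) (simp only: of_nat_le_iff)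
  also have "card Q = K ^ 3"
    unfolding Q_def by (simp add: card_cartesian_product power3_eq_cube)
  finally show ?thesis by simp
qed

end

section \<open>Combining the block estimate with the (6,3) theorem\<close>

text \<open>The number of blocks is fixed from \<open>c\<close> alone, so that triples with a close
  pair use half of the bound; the (6,3) theorem is then applied with precision small enough for the
  \<open>K ^ 3\<close> pieces to share the other half.\<close>

lemma card_edges_le:
  fixes c :: real
  assumes c: "0 < c"
  obtains n0 where "\<And>H :: nat ordered_hypergraph. \<lbrakk>ordered_three_graph H; n0 \<le> card (verts H);
      \<And>G. G \<in> ord_family F_RS \<Longrightarrow> \<not> contains H G\<rbrakk>
    \<Longrightarrow> card (edges H) \<le> c * (card (verts H))\<^sup>2"
proof -
  \<comment> \<open>The block length will be at most 2n/K, so triples with a close pair number at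
    most 4n^2/K, and \<open>8 / c < K\<close> turns this into c/2 times n^2.\<close>
  obtain K :: nat where K: "8 / c < K" using reals_Archimedean2 by blast
  then have Kpos: "0 < K" using c by (metis divide_pos_pos less_trans of_nat_0_less_iff zero_less_numeral)
  define \<epsilon> where "\<epsilon> = c / (2 * real K ^ 3)"
  have \<epsilon>: "0 < \<epsilon>" unfolding \<epsilon>_def using c Kpos by simp
  obtain n0 where n0: "\<And>(V :: nat set) T. \<lbrakk>finite V; n0 \<le> card V; T \<subseteq> V \<times> V \<times> V;
      tripartite_RS_free T\<rbrakk> \<Longrightarrow> card T \<le> \<epsilon> * (card V)\<^sup>2"
    using card_tripartite_RS_free_le[OF \<epsilon>] by blast
  show thesis
  \<comment> \<open>Having at least \<open>K\<close> vertices ensures that the extra 1 in the block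
    length \<open>L\<close> is at most n/K.\<close>
  proof (rule that[of "max n0 K"])
    fix H :: "nat ordered_hypergraph"
    assume H: "ordered_three_graph H" and n: "max n0 K \<le> card (verts H)"
      and free: "\<And>G. G \<in> ord_family F_RS \<Longrightarrow> \<not> contains H G"
    define n where "n = card (verts H)"
    have V: "finite (verts H)" "linear_order_on (verts H) (vle H)"
      using H unfolding ordered_three_graph_def three_graph_def by auto
    obtain \<rho> where "ranked_three_graph H \<rho>"
    proof (rule linear_order_rank[OF V])
      fix \<rho> :: "nat \<Rightarrow> nat"
      assume "inj_on \<rho> (verts H)" "\<And>x. x \<in> verts H \<Longrightarrow> \<rho> x < card (verts H)"
        "\<And>x y. x \<in> verts H \<Longrightarrow> y \<in> verts H \<Longrightarrow> (x, y) \<in> vle H \<longleftrightarrow> \<rho> x \<le> \<rho> y"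
      then have "ranked_three_graph H \<rho>" using H free by unfold_locales
      then show thesis by (rule that)
    qed
    then interpret ranked_three_graph H \<rho> .
    \<comment> \<open>Rounding up keeps \<open>L\<close> positive and lets \<open>K\<close> blocks
      cover all ranks.\<close>
    define L where "L = n div K + 1"
    have KL: "n \<le> K * L"
      unfolding L_def using dividend_less_times_div[OF Kpos, of n] by simp
    have piece: "card {(x, y, z) \<in> triples. \<rho> x div L = i \<and> \<rho> y div L = j \<and> \<rho> z div L = k} \<le> \<epsilon> * n\<^sup>2"
      (is "real (card ?T) \<le> _") if ij: "i < j" "j < k" for i j k
      unfolding n_def
    proof (rule n0)
      show "finite (verts H)" by (rule finite_verts)
      show "n0 \<le> card (verts H)" using n by simp
      show "?T \<subseteq> verts H \<times> verts H \<times> verts H" by (auto dest: triplesD)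
      \<comment> \<open>Different block indices already order the ranks, so inside one piece the two
        comparisons demanded by \<open>triples_no_triangle\<close> hold automatically.\<close>
      have less: "\<rho> x < \<rho> y" if "\<rho> x div L < \<rho> y div L" for x y
        using that by (meson div_le_mono leD leI)
      have "c = c'" if t: "(a, b, c) \<in> ?T" "(a, b', c') \<in> ?T" "(a', b, c') \<in> ?T" for a a' b b' c c'
      proof (rule triples_no_triangle)
        show "\<rho> a' < \<rho> b'" "\<rho> b' < \<rho> c" using t ij by (auto intro: less)
      qed (use t in auto)
      then show "tripartite_RS_free ?T"
        unfolding tripartite_RS_free_def using triples_unique1 triples_unique2 triples_unique3 by blast
    qed
    have "card triples \<le> 2 * real (card (verts H)) * L + real K ^ 3 * (\<epsilon> * n\<^sup>2)"
      by (rule card_triples_le[OF _ _ piece]) (use KL \<epsilon> in \<open>auto simp: L_def n_def\<close>)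
    moreover have "2 * real n * L \<le> c / 2 * n\<^sup>2"
    proof -
      have "real (n div K) \<le> n / K" by (rule of_nat_div_le_of_nat)
      moreover have "1 \<le> real n / K" using n Kpos by (simp add: n_def)
      ultimately have "real L \<le> 2 * n / K" unfolding L_def by simp
      also have "\<dots> = (2 / K) * n" by simp
      also have "\<dots> \<le> (c / 4) * n"
        using K Kpos c by (intro mult_right_mono) (auto simp: field_simps)
      finally have "2 * real n * L \<le> 2 * real n * (c / 4 * n)"
        by (intro mult_left_mono) auto
      then show ?thesis by (simp add: power2_eq_square)
    qed
    moreover have "real K ^ 3 * (\<epsilon> * n\<^sup>2) = c / 2 * n\<^sup>2"
      unfolding \<epsilon>_def using Kpos by simp
    ultimately have "card triples \<le> c * n\<^sup>2" unfolding n_def[symmetric] by linarith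
    then show "card (edges H) \<le> c * (card (verts H))\<^sup>2"
      using card_edges_le_triples unfolding n_def by linarith
  qed
qed

theorem theorem1p7:
  shows "(\<lambda>n. real (ex_ordered n (ord_family F_RS))) \<in> o(\<lambda>n. real n ^ 2)"
proof (rule landau_o.smallI)
  fix c :: real assume "0 < c"
  then obtain n0 where n0: "\<And>H :: nat ordered_hypergraph. \<lbrakk>ordered_three_graph H; n0 \<le> card (verts H);
      \<And>G. G \<in> ord_family F_RS \<Longrightarrow> \<not> contains H G\<rbrakk>
    \<Longrightarrow> card (edges H) \<le> c * (card (verts H))\<^sup>2"
    using card_edges_le by blast
  have "norm (real (ex_ordered n (ord_family F_RS))) \<le> c * norm (real n ^ 2)" if n: "n0 \<le> n" for n
  proof -
    \<comment> \<open>The maximum is over a finite nonempty set, so it is attained by an extremal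
      graph, to which the edge bound applies.\<close>
    obtain H :: "nat ordered_hypergraph" where H: "ordered_three_graph H" "card (verts H) = n"
      "\<forall>G\<in>ord_family F_RS. \<not> contains H G" and "ex_ordered n (ord_family F_RS) = card (edges H)"
      using Max_in[OF finite_ex_ordered_set ex_ordered_set_nonempty, of n]
      unfolding ex_ordered_def by blast
    then show ?thesis using n0[OF H(1)] n by simp
  qed
  then show "\<forall>\<^sub>F n in at_top. norm (real (ex_ordered n (ord_family F_RS))) \<le> c * norm (real n ^ 2)"
    by (auto simp: eventually_at_top_linorder)
qed

end
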